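(* Fix $\alpha,\beta\in(0,\infty)$. Let $A_n$ be the number of $\alpha$'s on the second main diagonal of the random $\alpha/\beta$-staircase tableau $S_{n,\alpha,\beta}$, i.e. $A_n=\sum_{j=1}^{n-1}\mathbf{1}\{S_{n,\alpha,\beta}(j)=\alpha\}$. Then, as $n\to\infty$, $A_n$ converges in distribution to a Poisson random variable with parameter $1/2$.
   Context: A staircase tableau of size $n$ is a Young diagram of shape $(n,n-1,\dots,1)$ (row $i$ has boxes $(i,j)$, $1\le j\le n-i+1$; rows numbered top to bottom, columns left to right) whose boxes are empty or contain a symbol, such that: all boxes in the same column and above an $\alpha$ are empty; all boxes in the same row and to the left of a $\beta$ are empty; every box $(i,j)$ with $i+j=n+1$ (main diagonal) contains a symbol. An $\alpha/\beta$-staircase tableau uses only the symbols $\alpha,\beta$; its weight is $\alpha^{N_\alpha}\beta^{N_\beta}$ ($N_\alpha,N_\beta$ the numbers of $\alpha$'s and $\beta$'s). $S_{n,\alpha,\beta}$ is the random $\alpha/\beta$-staircase tableau of size $n$ with $\mathbb{P}(S_{n,\alpha,\beta}=S)=wt(S)/\sum_{S'}wt(S')$. The second main diagonal consists of the boxes $(n-i,i)$, $i=1,\dots,n-1$, and $S_{n,\alpha,\beta}(i)$ denotes the content of box $(n-i,i)$. *)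

theory Defs
  imports "HOL-Probability.Probability"
begin

text \<open>
  Box \<open>(i, j)\<close> is in row \<open>i\<close> (numbered from the top) and column \<open>j\<close> (numbered from the left),
  both starting at 1.
\<close>

definition staircase_shape :: "nat \<Rightarrow> (nat \<times> nat) set" where
  "staircase_shape n = {(i, j). 1 \<le> i \<and> i \<le> n \<and> 1 \<le> j \<and> j \<le> n - i + 1}"

datatype tableau_symbol = Alpha | Beta

text \<open>
  A filling maps each box to its content, \<open>None\<close> meaning that the box is empty.  Fillings are
  required to be \<open>None\<close> outside the shape, so that distinct elements of \<open>ab_staircase_tableaux n\<close>
  are distinct tableaux.
\<close>

type_synonym filling = "nat \<times> nat \<Rightarrow> tableau_symbol option"

definition ab_staircase_tableaux :: "nat \<Rightarrow> filling set" where
  "ab_staircase_tableaux n = {T.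
     (\<forall>b. b \<notin> staircase_shape n \<longrightarrow> T b = None) \<and>
     (\<forall>(i, j) \<in> staircase_shape n. T (i, j) = Some Alpha \<longrightarrow>
        (\<forall>i'. (i', j) \<in> staircase_shape n \<and> i' < i \<longrightarrow> T (i', j) = None)) \<and>
     (\<forall>(i, j) \<in> staircase_shape n. T (i, j) = Some Beta \<longrightarrow>
        (\<forall>j'. (i, j') \<in> staircase_shape n \<and> j' < j \<longrightarrow> T (i, j') = None)) \<and>
     (\<forall>(i, j) \<in> staircase_shape n. i + j = n + 1 \<longrightarrow> T (i, j) \<noteq> None)}"

definition symbol_count :: "nat \<Rightarrow> tableau_symbol \<Rightarrow> filling \<Rightarrow> nat" where
  "symbol_count n s T = card {b \<in> staircase_shape n. T b = Some s}"

definition tableau_weight :: "nat \<Rightarrow> real \<Rightarrow> real \<Rightarrow> filling \<Rightarrow> real" where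
  "tableau_weight n \<alpha> \<beta> T = \<alpha> ^ symbol_count n Alpha T * \<beta> ^ symbol_count n Beta T"

text \<open>
  The law of the random tableau.  The function below is a probability mass function for
  positive \<open>\<alpha>\<close>, \<open>\<beta>\<close>; see \<open>pmf_random_ab_tableau\<close>.
\<close>

definition random_ab_tableau :: "nat \<Rightarrow> real \<Rightarrow> real \<Rightarrow> filling pmf" where
  "random_ab_tableau n \<alpha> \<beta> = embed_pmf (\<lambda>T.
     if T \<in> ab_staircase_tableaux n
     then tableau_weight n \<alpha> \<beta> T / (\<Sum>T' \<in> ab_staircase_tableaux n. tableau_weight n \<alpha> \<beta> T')
     else 0)"

definition second_diagonal_alphas :: "nat \<Rightarrow> filling \<Rightarrow> nat" where
  "second_diagonal_alphas n T = (\<Sum>j = 1..<n. if T (n - j, j) = Some Alpha then 1 else 0)"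

lemma finite_ab_staircase_tableaux: "finite (ab_staircase_tableaux n)"
proof (rule finite_subset)
  have "staircase_shape n \<subseteq> {..n} \<times> {..n}"
    by (auto simp: staircase_shape_def)
  then have fin: "finite (staircase_shape n)"
    by (rule finite_subset) simp
  have U: "(UNIV :: tableau_symbol option set) = {None, Some Alpha, Some Beta}"
  proof (rule UNIV_eq_I)
    show "x \<in> {None, Some Alpha, Some Beta}" for x
      by (cases x rule: option.exhaust) (auto intro: tableau_symbol.exhaust)
  qed
  have "finite (UNIV :: tableau_symbol option set)"
    unfolding U by simp
  then show "finite {T :: filling. \<forall>b. (b \<in> staircase_shape n \<longrightarrow> T b \<in> UNIV) \<and>
      (b \<notin> staircase_shape n \<longrightarrow> T b = None)}"
    by (intro finite_set_of_finite_funs fin)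
qed (auto simp: ab_staircase_tableaux_def)

lemma ab_staircase_tableaux_nonempty: "ab_staircase_tableaux n \<noteq> {}"
proof -
  have "(\<lambda>(i, j). if (i, j) \<in> staircase_shape n \<and> i + j = n + 1 then Some Alpha else None)
      \<in> ab_staircase_tableaux n"
    by (auto simp: ab_staircase_tableaux_def)
  then show ?thesis by blast
qed

lemma pmf_random_ab_tableau:
  assumes "\<alpha> > 0" "\<beta> > 0"
  shows "pmf (random_ab_tableau n \<alpha> \<beta>) T =
    (if T \<in> ab_staircase_tableaux n
     then tableau_weight n \<alpha> \<beta> T / (\<Sum>T' \<in> ab_staircase_tableaux n. tableau_weight n \<alpha> \<beta> T')
     else 0)"
proof -
  let ?A = "ab_staircase_tableaux n"
  let ?Z = "\<Sum>T' \<in> ?A. tableau_weight n \<alpha> \<beta> T'"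
  let ?f = "\<lambda>T. if T \<in> ?A then tableau_weight n \<alpha> \<beta> T / ?Z else 0"
  have pos: "tableau_weight n \<alpha> \<beta> T > 0" for T
    using assms by (simp add: tableau_weight_def)
  have Z: "?Z > 0"
    by (intro sum_pos finite_ab_staircase_tableaux ab_staircase_tableaux_nonempty pos)
  have nn: "?f T \<ge> 0" for T
    using pos[of T] Z by (simp add: less_imp_le)
  have "(\<integral>\<^sup>+T. ennreal (?f T) \<partial>count_space UNIV) = (\<Sum>T\<in>?A. ennreal (?f T))"
    by (rule nn_integral_count_space') (auto simp: finite_ab_staircase_tableaux)
  also have "\<dots> = ennreal (\<Sum>T\<in>?A. ?f T)"
    by (rule sum_ennreal) (rule nn)
  also have "(\<Sum>T\<in>?A. ?f T) = 1"
    using Z by (simp flip: sum_divide_distrib)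
  finally show ?thesis
    unfolding random_ab_tableau_def by (intro pmf_embed_pmf nn) simp
qed

end

theory Submission
  imports Defs "HOL-Real_Asymp.Real_Asymp"
begin

text \<open>
  Let \<open>P\<^sub>n(x)\<close> be the weighted sum over all tableaux of size \<open>n\<close> of
  \<open>t\<close> to the number of \<open>\<alpha>\<close>'s on the second diagonal times \<open>x\<close> to the number of rows without
  a \<open>\<beta>\<close>.  Only those rows and the new bottom row can receive symbols when a first column is added,
  and the second diagonal gains an \<open>\<alpha>\<close> only if that column is \<open>\<alpha>\<close> above \<open>\<beta>\<close> in the last two rows, so
  \<open>P\<^sub>n(x) = (\<alpha>x + \<beta>) P\<^bsub>n-1\<^esub>(x + \<beta>) + (t - 1) \<alpha>\<^sup>2\<beta>x P\<^bsub>n-2\<^esub>(x)\<close>.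
  With \<open>x = \<beta>y\<close> and \<open>a = 1/\<alpha>\<close>, this is solved by expanding in powers of \<open>t - 1\<close>: the \<open>k\<close>-th coefficient
  is \<open>(\<alpha>\<beta>)\<^sup>n\<close> times the rising factorial of \<open>y + a\<close> of length \<open>n - 2k\<close> times the complete homogeneous
  symmetric polynomial of degree \<open>k\<close> in \<open>y, y + 1, \<dots>, y + n - 2k\<close>.  Hence the \<open>k\<close>-th binomial moment is
  at most \<open>1/k!\<close> and, by the Stolz-Cesaro theorem, tends to \<open>1/(2\<^sup>k k!)\<close>.  By Tannery's theorem the
  characteristic functions converge, and Levy's continuity theorem applies.
\<close>

section \<open>Filling one column\<close>

text \<open>\<open>F\<close> lists the rows that may receive a symbol. The rule for
  \<open>Beta\<close> concerns boxes further right in each row, so it enters only through the choice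
  of \<open>F\<close>.\<close>

definition column_fillings :: "nat set \<Rightarrow> (nat \<Rightarrow> tableau_symbol option) set" where
  "column_fillings F = {c. (\<forall>i. c i \<noteq> None \<longrightarrow> i \<in> F) \<and>
     (\<forall>i i'. c i = Some Alpha \<longrightarrow> i' < i \<longrightarrow> c i' = None)}"

text \<open>
  Besides \<open>u\<close> for an \<open>\<alpha>\<close> and \<open>v\<close> for a \<open>\<beta>\<close>, a box contributes \<open>x\<close> whenever its row stays without \<open>\<beta>\<close>.
\<close>

definition entry_weight :: "'a::comm_ring_1 \<Rightarrow> 'a \<Rightarrow> 'a \<Rightarrow> tableau_symbol option \<Rightarrow> 'a" where
  "entry_weight u v x s = (case s of None \<Rightarrow> x | Some Alpha \<Rightarrow> u * x | Some Beta \<Rightarrow> v)"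

lemma entry_weight_simps [simp]:
  "entry_weight u v x None = x"
  "entry_weight u v x (Some Alpha) = u * x"
  "entry_weight u v x (Some Beta) = v"
  by (simp_all add: entry_weight_def)

lemma symbol_option_cases: "s = None \<or> s = Some Alpha \<or> s = Some Beta"
  by (cases s) (auto intro: tableau_symbol.exhaust)

text \<open>The exponents are the gains in \<open>Alpha\<close>s, in \<open>Beta\<close>s and in
  rows left without \<open>Beta\<close>, so one product over boxes records these statistics of a new
  column.\<close>

lemma prod_entry_weight:
  assumes "finite F"
  shows "(\<Prod>i\<in>F. entry_weight u v x (c i)) =
    u ^ card {i \<in> F. c i = Some Alpha} * v ^ card {i \<in> F. c i = Some Beta}
      * x ^ card {i \<in> F. c i \<noteq> Some Beta}"
  using assms
proof induction
  case (insert m F)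
  have eq: "card {i \<in> insert m F. P (c i)} = of_bool (P (c m)) + card {i \<in> F. P (c i)}" for P
  proof -
    have "{i \<in> insert m F. P (c i)} = (if P (c m) then insert m {i \<in> F. P (c i)} else {i \<in> F. P (c i)})"
      by auto
    then show ?thesis using insert.hyps by simp
  qed
  show ?case
    unfolding eq[of "\<lambda>s. s = Some Alpha"] eq[of "\<lambda>s. s = Some Beta"]
      eq[of "\<lambda>s. s \<noteq> Some Beta"]
    using symbol_option_cases[of "c m"] insert.IH insert.hyps
    by (elim disjE) (simp_all add: algebra_simps)
qed simp

lemma column_fillings_empty: "column_fillings {} = {\<lambda>_. None}"
  by (auto simp: column_fillings_def)

lemma finite_column_fillings:
  assumes "finite F"
  shows "finite (column_fillings F)"
proof (rule finite_subset)
  show "finite {c. \<forall>i. (i \<in> F \<longrightarrow> c i \<in> {None, Some Alpha, Some Beta}) \<and> (i \<notin> F \<longrightarrow> c i = None)}"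
    using assms by (intro finite_set_of_finite_funs) auto
  show "column_fillings F \<subseteq> \<dots>"
    using symbol_option_cases by (auto simp: column_fillings_def)
qed

lemma column_fillings_Alpha:
  assumes "c \<in> column_fillings F" "c m = Some Alpha" "\<forall>i\<in>F. i \<le> m"
  shows "c = (\<lambda>_. None)(m := Some Alpha)"
proof
  fix i
  show "c i = ((\<lambda>_. None)(m := Some Alpha)) i"
    using assms unfolding column_fillings_def
    by (cases i m rule: linorder_cases) (auto dest: leD simp del: not_None_eq)
qed

text \<open>An \<open>Alpha\<close> in the bottom box empties the column above it; a
  \<open>Beta\<close> there leaves the rest of the column unrestricted.\<close>

lemma nonempty_bottom_eq:
  assumes "\<forall>i\<in>F. i < m"
  shows "{c \<in> column_fillings (insert m F). c m \<noteq> None} =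
    insert ((\<lambda>_. None)(m := Some Alpha)) ((\<lambda>c. c(m := Some Beta)) ` column_fillings F)" (is "?L = ?R")
proof
  show "?L \<subseteq> ?R"
  proof
    fix c assume c: "c \<in> ?L"
    show "c \<in> ?R"
    proof (cases "c m = Some Alpha")
      case True
      have "c = (\<lambda>_. None)(m := Some Alpha)"
        using c True assms by (intro column_fillings_Alpha[of _ "insert m F"]) (auto simp: less_imp_le)
      then show ?thesis by simp
    next
      case False
      then have b: "c m = Some Beta"
        using c symbol_option_cases[of "c m"] by auto
      have "c(m := None) \<in> column_fillings F"
        using c by (auto simp: column_fillings_def)
      moreover have "c = (c(m := None))(m := Some Beta)"
        using b by auto
      ultimately show ?thesis by (intro insertI2 image_eqI)
    qed
  qed
  show "?R \<subseteq> ?L"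
    using assms by (fastforce simp: column_fillings_def split: if_splits)
qed

lemma column_fillings_insert:
  assumes "\<forall>i\<in>F. i < m"
  shows "column_fillings (insert m F) =
    {c \<in> column_fillings (insert m F). c m \<noteq> None} \<union> column_fillings F"
  using assms by (auto simp: column_fillings_def)

lemma sum_nonempty_bottom:
  assumes "finite F" "\<forall>i\<in>F. i < m"
  shows "(\<Sum>c | c \<in> column_fillings (insert m F) \<and> c m \<noteq> None. g c) =
    g ((\<lambda>_. None)(m := Some Alpha)) + (\<Sum>c\<in>column_fillings F. g (c(m := Some Beta)))"
proof -
  have "m \<notin> F"
    using assms(2) by blast
  then have empty_m: "c m = None" if "c \<in> column_fillings F" for c
    using that by (auto simp: column_fillings_def)
  have "inj_on (\<lambda>c. c(m := Some Beta)) (column_fillings F)"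
    by (rule inj_onI) (metis empty_m fun_upd_triv fun_upd_upd)
  moreover have "(\<lambda>_. None)(m := Some Alpha) \<notin> (\<lambda>c. c(m := Some Beta)) ` column_fillings F"
    by (auto dest: fun_cong[of _ _ m])
  ultimately show ?thesis
    unfolding nonempty_bottom_eq[OF assms(2)]
    by (subst sum.insert) (simp_all add: finite_column_fillings assms(1) sum.reindex)
qed

lemma prod_entry_weight_upd:
  assumes "finite F" "m \<notin> F"
  shows "(\<Prod>i\<in>insert m F. entry_weight u v x ((c(m := s)) i)) =
    entry_weight u v x s * (\<Prod>i\<in>F. entry_weight u v x (c i))"
proof -
  have "(\<Prod>i\<in>F. entry_weight u v x ((c(m := s)) i)) = (\<Prod>i\<in>F. entry_weight u v x (c i))"
    using assms(2) by (intro prod.cong) auto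
  then show ?thesis using assms by simp
qed

text \<open>The left side is the weight of all columns with one more, filled box below
  \<open>F\<close>: \<open>Beta\<close> there gives the first term, \<open>Alpha\<close> the second.
  Each new largest row of \<open>F\<close> multiplies it by \<open>x + v\<close>. Keeping the factor
  \<open>v\<close> avoids a division in the ring.\<close>

lemma sum_column_fillings:
  assumes "finite F"
  shows "v * (\<Sum>c\<in>column_fillings F. \<Prod>i\<in>F. entry_weight u v x (c i)) + u * x * x ^ card F
    = (u * x + v) * (x + v) ^ card F"
  using assms
proof (induction rule: finite_linorder_max_induct)
  case empty
  then show ?case by (simp add: column_fillings_empty)
next
  case (insert m F)
  let ?W = "\<lambda>F. \<Sum>c\<in>column_fillings F. \<Prod>i\<in>F. entry_weight u v x (c i)"
  have m: "m \<notin> F"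
    using insert.hyps by blast
  have disj: "{c \<in> column_fillings (insert m F). c m \<noteq> None} \<inter> column_fillings F = {}"
    using m by (auto simp: column_fillings_def)
  have fin: "finite (column_fillings (insert m F))" "finite (column_fillings F)"
    using insert.hyps by (auto intro: finite_column_fillings)
  have "?W (insert m F) = (\<Sum>c | c \<in> column_fillings (insert m F) \<and> c m \<noteq> None.
        \<Prod>i\<in>insert m F. entry_weight u v x (c i))
      + (\<Sum>c\<in>column_fillings F. \<Prod>i\<in>insert m F. entry_weight u v x (c i))"
    by (subst column_fillings_insert[OF insert.hyps(2)], subst sum.union_disjoint)
       (use fin disj in auto)
  also have "(\<Sum>c | c \<in> column_fillings (insert m F) \<and> c m \<noteq> None.
        \<Prod>i\<in>insert m F. entry_weight u v x (c i)) = u * x * x ^ card F + v * ?W F"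
    unfolding sum_nonempty_bottom[OF insert.hyps(1,2)] prod_entry_weight_upd[OF insert.hyps(1) m]
    by (simp add: sum_distrib_left)
  also have "(\<Sum>c\<in>column_fillings F. \<Prod>i\<in>insert m F. entry_weight u v x (c i)) = x * ?W F"
    unfolding sum_distrib_left
  proof (rule sum.cong[OF refl])
    fix c assume "c \<in> column_fillings F"
    then have "c m = None" using m by (auto simp: column_fillings_def)
    then show "(\<Prod>i\<in>insert m F. entry_weight u v x (c i)) = x * (\<Prod>i\<in>F. entry_weight u v x (c i))"
      using m insert.hyps by simp
  qed
  finally have W: "?W (insert m F) = u * x * x ^ card F + v * ?W F + x * ?W F" .
  have "v * ?W (insert m F) + u * x * x ^ card (insert m F)
      = (x + v) * (v * ?W F + u * x * x ^ card F)"
    unfolding W using m insert.hyps by (simp add: algebra_simps)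
  also have "\<dots> = (x + v) * ((u * x + v) * (x + v) ^ card F)"
    by (simp only: insert.IH)
  finally show ?case
    using m insert.hyps by (simp add: algebra_simps)
qed

lemma sum_column_fillings_Alpha:
  assumes "finite F" "\<forall>i\<in>F. i \<le> k"
  shows "(\<Sum>c\<in>column_fillings F. if c k = Some Alpha then (\<Prod>i\<in>F. entry_weight u v x (c i)) else 0)
    = (if k \<in> F then u * x ^ card F else 0)"
proof (cases "k \<in> F")
  case True
  let ?a = "(\<lambda>_. None)(k := Some Alpha)"
  have a: "?a \<in> column_fillings F"
    using True by (auto simp: column_fillings_def)
  have "(\<Prod>i\<in>F. entry_weight u v x (?a i)) =
      (\<Prod>i\<in>insert k (F - {k}). entry_weight u v x (?a i))"
    using True by (simp add: insert_absorb)
  also have "\<dots> = u * x * x ^ card (F - {k})"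
    using assms(1) by (subst prod_entry_weight_upd) auto
  also have "\<dots> = u * x ^ card F"
    using card.remove[OF assms(1) True] by (simp add: mult.assoc)
  finally have p: "(\<Prod>i\<in>F. entry_weight u v x (?a i)) = u * x ^ card F" .
  have "(\<Sum>c\<in>column_fillings F. if c k = Some Alpha then (\<Prod>i\<in>F. entry_weight u v x (c i)) else 0)
      = (\<Sum>c\<in>column_fillings F. if c = ?a then (\<Prod>i\<in>F. entry_weight u v x (?a i)) else 0)"
  proof (rule sum.cong[OF refl])
    fix c assume "c \<in> column_fillings F"
    then have "c k = Some Alpha \<longleftrightarrow> c = ?a"
      using column_fillings_Alpha[of c F k] assms(2) by auto
    then show "(if c k = Some Alpha then (\<Prod>i\<in>F. entry_weight u v x (c i)) else 0)
        = (if c = ?a then (\<Prod>i\<in>F. entry_weight u v x (?a i)) else 0)"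
      by (cases "c = ?a") simp_all
  qed
  also have "\<dots> = u * x ^ card F"
    using a p finite_column_fillings[OF assms(1)] by (subst sum.delta) auto
  finally show ?thesis using True by simp
next
  case False
  then show ?thesis
    by (auto simp: column_fillings_def intro!: sum.neutral)
qed

text \<open>Here \<open>m\<close> is the new bottom row and \<open>k\<close> the row of the new
  second-diagonal box. A bottom \<open>Alpha\<close> empties row \<open>k\<close>; above a bottom
  \<open>Beta\<close>, an \<open>Alpha\<close> in row \<open>k\<close> determines the column, so the
  correction for \<open>t\<close> is a single term.\<close>

lemma sum_columns:
  assumes "finite F" "\<forall>i\<in>F. i \<le> k" "k < m"
  shows "(\<Sum>c | c \<in> column_fillings (insert m F) \<and> c m \<noteq> None.
      (\<Prod>i\<in>insert m F. entry_weight u v x (c i)) * (if c k = Some Alpha then t else 1))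
    = (u * x + v) * (x + v) ^ card F + (if k \<in> F then (t - 1) * u * v * x ^ card F else 0)"
proof -
  have lt: "\<forall>i\<in>F. i < m" and m: "m \<notin> F"
    using assms by fastforce+
  let ?p = "\<lambda>c. \<Prod>i\<in>F. entry_weight u v x (c i)"
  have "(\<Sum>c | c \<in> column_fillings (insert m F) \<and> c m \<noteq> None.
      (\<Prod>i\<in>insert m F. entry_weight u v x (c i)) * (if c k = Some Alpha then t else 1))
    = u * x * x ^ card F + (\<Sum>c\<in>column_fillings F. v * ?p c * (if c k = Some Alpha then t else 1))"
    unfolding sum_nonempty_bottom[OF assms(1) lt] prod_entry_weight_upd[OF assms(1) m]
    using assms(3) by simp
  \<comment> \<open>Writing \<open>t = 1 + (t - 1)\<close> separates the plain column sum from the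
    columns with \<open>Alpha\<close> in row \<open>k\<close>.\<close>
  also have "(\<Sum>c\<in>column_fillings F. v * ?p c * (if c k = Some Alpha then t else 1))
    = (\<Sum>c\<in>column_fillings F. v * ?p c + v * (t - 1) * (if c k = Some Alpha then ?p c else 0))"
    by (rule sum.cong) (auto simp: algebra_simps)
  also have "\<dots> = v * (\<Sum>c\<in>column_fillings F. ?p c)
      + v * (t - 1) * (\<Sum>c\<in>column_fillings F. if c k = Some Alpha then ?p c else 0)"
    by (simp add: sum.distrib sum_distrib_left)
  also have "(\<Sum>c\<in>column_fillings F. if c k = Some Alpha then ?p c else 0)
      = (if k \<in> F then u * x ^ card F else 0)"
    by (rule sum_column_fillings_Alpha[OF assms(1,2)])
  also have "v * (\<Sum>c\<in>column_fillings F. ?p c) =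
      (u * x + v) * (x + v) ^ card F - u * x * x ^ card F"
    unfolding eq_diff_eq by (rule sum_column_fillings[OF assms(1)])
  finally show ?thesis
    by (simp add: mult.assoc mult.left_commute)
qed

section \<open>Adding a first column to a tableau\<close>

lemma ab_staircase_tableaux_iff:
  "T \<in> ab_staircase_tableaux n \<longleftrightarrow>
     (\<forall>i j. T (i, j) \<noteq> None \<longrightarrow> 1 \<le> i \<and> 1 \<le> j \<and> i + j \<le> n + 1) \<and>
     (\<forall>i j i'. T (i, j) = Some Alpha \<longrightarrow> i' < i \<longrightarrow> T (i', j) = None) \<and>
     (\<forall>i j j'. T (i, j) = Some Beta \<longrightarrow> j' < j \<longrightarrow> T (i, j') = None) \<and>
     (\<forall>i j. 1 \<le> i \<longrightarrow> 1 \<le> j \<longrightarrow> i + j = n + 1 \<longrightarrow> T (i, j) \<noteq> None)"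
proof -
  have S: "(i, j) \<in> staircase_shape n \<longleftrightarrow> 1 \<le> i \<and> 1 \<le> j \<and> i + j \<le> n + 1" for i j
    by (auto simp: staircase_shape_def)
  have N: "(\<forall>b. b \<notin> staircase_shape n \<longrightarrow> T b = None) \<longleftrightarrow>
      (\<forall>i j. T (i, j) \<noteq> None \<longrightarrow> 1 \<le> i \<and> 1 \<le> j \<and> i + j \<le> n + 1)"
    using S by (metis prod.exhaust_sel)
  show ?thesis
    unfolding ab_staircase_tableaux_def mem_Collect_eq N
    unfolding Ball_def split_paired_All case_prod_conv S
  proof (intro conj_cong refl)
    assume N': "\<forall>i j. T (i, j) \<noteq> None \<longrightarrow> 1 \<le> i \<and> 1 \<le> j \<and> i + j \<le> n + 1"
    show "(\<forall>i j. 1 \<le> i \<and> 1 \<le> j \<and> i + j \<le> n + 1 \<longrightarrow> T (i, j) = Some Alpha \<longrightarrow>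
        (\<forall>i'. (1 \<le> i' \<and> 1 \<le> j \<and> i' + j \<le> n + 1) \<and> i' < i \<longrightarrow> T (i', j) = None)) \<longleftrightarrow>
      (\<forall>i j i'. T (i, j) = Some Alpha \<longrightarrow> i' < i \<longrightarrow> T (i', j) = None)"
      (is "?L \<longleftrightarrow> ?R")
    proof
      assume L: ?L
      show ?R
      proof (intro allI impI, rule ccontr)
        fix i j i' assume "T (i, j) = Some Alpha" "i' < i" "T (i', j) \<noteq> None"
        moreover from this N' have "1 \<le> i \<and> 1 \<le> j \<and> i + j \<le> n + 1" "1 \<le> i' \<and> 1 \<le> j \<and> i' + j \<le> n + 1"
          by auto
        ultimately show False using L[rule_format, of i j i'] by simp
      qed
    qed simp
    show "(\<forall>i j. 1 \<le> i \<and> 1 \<le> j \<and> i + j \<le> n + 1 \<longrightarrow> T (i, j) = Some Beta \<longrightarrow>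
        (\<forall>j'. (1 \<le> i \<and> 1 \<le> j' \<and> i + j' \<le> n + 1) \<and> j' < j \<longrightarrow> T (i, j') = None)) \<longleftrightarrow>
      (\<forall>i j j'. T (i, j) = Some Beta \<longrightarrow> j' < j \<longrightarrow> T (i, j') = None)"
      (is "?L \<longleftrightarrow> ?R")
    proof
      assume L: ?L
      show ?R
      proof (intro allI impI, rule ccontr)
        fix i j j' assume "T (i, j) = Some Beta" "j' < j" "T (i, j') \<noteq> None"
        moreover from this N' have "1 \<le> i \<and> 1 \<le> j \<and> i + j \<le> n + 1" "1 \<le> i \<and> 1 \<le> j' \<and> i + j' \<le> n + 1"
          by auto
        ultimately show False using L[rule_format, of i j j'] by simp
      qed
    qed simp
  next
    show "(\<forall>i j. 1 \<le> i \<and> 1 \<le> j \<and> i + j \<le> n + 1 \<longrightarrow> i + j = n + 1 \<longrightarrow> T (i, j) \<noteq> None) \<longleftrightarrow>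
      (\<forall>i j. 1 \<le> i \<longrightarrow> 1 \<le> j \<longrightarrow> i + j = n + 1 \<longrightarrow> T (i, j) \<noteq> None)"
      by auto
  qed
qed

definition free_rows :: "nat \<Rightarrow> filling \<Rightarrow> nat set" where
  "free_rows n T = {i \<in> {1..n}. \<forall>j. T (i, j) \<noteq> Some Beta}"

text \<open>Column 0 lies outside every shape, hence its value \<open>None\<close>; the old columns
  move one step to the right and keep their rows.\<close>

definition add_column :: "(nat \<Rightarrow> tableau_symbol option) \<Rightarrow> filling \<Rightarrow> filling" where
  "add_column c T = (\<lambda>(i, j). if j = 0 then None else if j = 1 then c i else T (i, j - 1))"

text \<open>The box of the new column in row \<open>Suc n\<close> lies on the main diagonal, so it
  must be filled.\<close>

definition first_columns :: "nat \<Rightarrow> filling \<Rightarrow> (nat \<Rightarrow> tableau_symbol option) set" where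
  "first_columns n T = {c \<in> column_fillings (insert (Suc n) (free_rows n T)). c (Suc n) \<noteq> None}"

lemma finite_free_rows [simp]: "finite (free_rows n T)"
  by (simp add: free_rows_def)

lemma add_column_simps [simp]:
  "add_column c T (i, 0) = None" "add_column c T (i, Suc 0) = c i"
  "add_column c T (i, Suc (Suc j)) = T (i, Suc j)"
  by (simp_all add: add_column_def)

lemma add_column_in_tableaux:
  assumes T: "T \<in> ab_staircase_tableaux n" and c: "c \<in> first_columns n T"
  shows "add_column c T \<in> ab_staircase_tableaux (Suc n)"
proof -
  have c1: "i \<in> insert (Suc n) (free_rows n T)" if "c i \<noteq> None" for i
    using c that by (auto simp: first_columns_def column_fillings_def)
  have c2: "c i' = None" if "c i = Some Alpha" "i' < i" for i i'
    using c that by (auto simp: first_columns_def column_fillings_def)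
  have c3: "c (Suc n) \<noteq> None"
    using c by (auto simp: first_columns_def)
  have T': "T (i, j) \<noteq> None \<Longrightarrow> 1 \<le> i \<and> 1 \<le> j \<and> i + j \<le> n + 1"
    "T (i, j) = Some Alpha \<Longrightarrow> i' < i \<Longrightarrow> T (i', j) = None"
    "T (i, j) = Some Beta \<Longrightarrow> j' < j \<Longrightarrow> T (i, j') = None"
    "1 \<le> i \<Longrightarrow> 1 \<le> j \<Longrightarrow> i + j = n + 1 \<Longrightarrow> T (i, j) \<noteq> None" for i j i' j'
    using T unfolding ab_staircase_tableaux_iff by blast+
  have j3: "j = 0 \<or> j = Suc 0 \<or> (\<exists>k. j = Suc (Suc k))" for j :: nat
    by presburger
  show ?thesis
    unfolding ab_staircase_tableaux_iff
  proof (intro conjI allI impI)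
    fix i j assume a: "add_column c T (i, j) \<noteq> None"
    have "1 \<le> i \<and> 1 \<le> j \<and> i + j \<le> Suc n + 1"
      using j3[of j] a c1[of i] T'(1)[of i "j - 1"] by (auto simp: free_rows_def)
    then show "1 \<le> i" "1 \<le> j" "i + j \<le> Suc n + 1" by auto
  next
    fix i j i' assume "add_column c T (i, j) = Some Alpha" "i' < i"
    then show "add_column c T (i', j) = None"
      using j3[of j] c2 T'(2) by auto
  next
    fix i j j' assume a: "add_column c T (i, j) = Some Beta" "j' < j"
    show "add_column c T (i, j') = None"
    \<comment> \<open>A \<open>Beta\<close> of \<open>T\<close> lies in a row
      \<open>i \<le> n\<close> that is not free, so the new box in this row is empty.\<close>
    proof (cases "j' = Suc 0")
      case True
      then obtain k where k: "j = Suc (Suc k)" using j3[of j] a by auto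
      then have b: "T (i, Suc k) = Some Beta" using a by auto
      then have "i \<le> n" using T'(1)[of i "Suc k"] by auto
      then have "c i = None" using c1[of i] b by (cases "c i") (auto simp: free_rows_def)
      then show ?thesis using True by simp
    next
      case False
      then show ?thesis using j3[of j] j3[of j'] a T'(3) by auto
    qed
  next
    fix i j :: nat assume "1 \<le> i" "1 \<le> j" "i + j = Suc n + 1"
    then show "add_column c T (i, j) \<noteq> None"
      using j3[of j] c3 T'(4) by auto
  qed
qed

text \<open>Deleting the first column inverts the construction: the other columns form a tableau of
  size \<open>n\<close>, and a filled first box has no \<open>Beta\<close> to its right, so its row
  is free or the new bottom row.\<close>

lemma ab_staircase_tableaux_Suc:
  "ab_staircase_tableaux (Suc n) =
    (\<lambda>(T, c). add_column c T) ` (SIGMA T : ab_staircase_tableaux n. first_columns n T)"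
proof (intro equalityI subsetI)
  fix S assume S: "S \<in> ab_staircase_tableaux (Suc n)"
  have S1: "S (i, j) \<noteq> None \<Longrightarrow> 1 \<le> i \<and> 1 \<le> j \<and> i + j \<le> Suc n + 1"
    and S2: "S (i, j) = Some Alpha \<Longrightarrow> i' < i \<Longrightarrow> S (i', j) = None"
    and S3: "S (i, j) = Some Beta \<Longrightarrow> j' < j \<Longrightarrow> S (i, j') = None"
    and S4: "1 \<le> i \<Longrightarrow> 1 \<le> j \<Longrightarrow> i + j = Suc n + 1 \<Longrightarrow> S (i, j) \<noteq> None" for i j i' j'
    using S unfolding ab_staircase_tableaux_iff by blast+
  define c where "c i = S (i, 1)" for i
  define T where "T = (\<lambda>(i, j). if j = 0 then None else S (i, Suc j))"
  have T_Some: "j \<noteq> 0 \<and> S (i, Suc j) = Some s" if "T (i, j) = Some s" for i j s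
    using that by (simp add: T_def split: if_splits)
  have eq: "S = add_column c T"
  proof
    fix b :: "nat \<times> nat"
    obtain i j where b: "b = (i, j)" by fastforce
    have "S (i, 0) = None" using S1[of i 0] by (cases "S (i, 0)") auto
    moreover have "j = 0 \<or> j = Suc 0 \<or> (\<exists>k. j = Suc (Suc k))" by presburger
    ultimately show "S b = add_column c T b"
      unfolding b by (auto simp: c_def T_def)
  qed
  have T: "T \<in> ab_staircase_tableaux n"
    unfolding ab_staircase_tableaux_iff
  proof (intro conjI allI impI)
    fix i j assume "T (i, j) \<noteq> None"
    then have "j \<noteq> 0" "S (i, Suc j) \<noteq> None" using T_Some by blast+
    then show "1 \<le> i" "1 \<le> j" "i + j \<le> n + 1" using S1[of i "Suc j"] by simp_all
  next
    fix i j i' assume "T (i, j) = Some Alpha" "i' < i"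
    then have "S (i', Suc j) = None" using T_Some S2 by blast
    then show "T (i', j) = None" by (simp add: T_def)
  next
    fix i j j' assume "T (i, j) = Some Beta" "j' < j"
    then have "S (i, Suc j') = None" using T_Some S3 Suc_mono by blast
    then show "T (i, j') = None" by (simp add: T_def)
  next
    fix i j :: nat assume "1 \<le> i" "1 \<le> j" "i + j = n + 1"
    then show "T (i, j) \<noteq> None" using S4[of i "Suc j"] by (simp add: T_def)
  qed
  have "c \<in> first_columns n T"
    unfolding first_columns_def column_fillings_def mem_Collect_eq
  proof (intro conjI allI impI)
    fix i assume ci: "c i \<noteq> None"
    have "T (i, j) \<noteq> Some Beta" for j
      using T_Some[of i j Beta] S3[of i "Suc j" 1] ci by (auto simp: c_def)
    then show "i \<in> insert (Suc n) (free_rows n T)"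
      using S1[of i 1] ci by (auto simp: free_rows_def c_def)
  next
    fix i i' assume "c i = Some Alpha" "i' < i"
    then show "c i' = None" using S2 unfolding c_def by simp
  next
    show "c (Suc n) \<noteq> None" using S4[of "Suc n" 1] by (simp add: c_def)
  qed
  with T eq show "S \<in> (\<lambda>(T, c). add_column c T) ` (SIGMA T : ab_staircase_tableaux n. first_columns n T)"
    by (intro image_eqI[of _ _ "(T, c)"]) auto
next
  fix S assume "S \<in> (\<lambda>(T, c). add_column c T) ` (SIGMA T : ab_staircase_tableaux n. first_columns n T)"
  then show "S \<in> ab_staircase_tableaux (Suc n)"
    using add_column_in_tableaux by auto
qed

lemma inj_on_add_column:
  "inj_on (\<lambda>(T, c). add_column c T) (SIGMA T : ab_staircase_tableaux n. first_columns n T)"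
proof (rule inj_onI, clarify)
  fix T c T' c'
  assume T: "T \<in> ab_staircase_tableaux n" "T' \<in> ab_staircase_tableaux n"
    and eq: "add_column c T = add_column c' T'"
  have "c i = c' i" for i
    using fun_cong[OF eq, of "(i, Suc 0)"] by simp
  moreover have "T (i, j) = T' (i, j)" for i j
  proof (cases j)
    case 0
    then show ?thesis using T unfolding ab_staircase_tableaux_iff by (metis not_one_le_zero)
  next
    case (Suc k)
    then show ?thesis using fun_cong[OF eq, of "(i, Suc j)"] by simp
  qed
  ultimately show "T = T' \<and> c = c'" by auto
qed

section \<open>Change of the statistics when a column is added\<close>

lemma symbol_count_alt:
  assumes "T \<in> ab_staircase_tableaux n"
  shows "symbol_count n s T = card {b. T b = Some s}"
proof -
  have "T b = None" if "b \<notin> staircase_shape n" for b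
    using assms that unfolding ab_staircase_tableaux_def by blast
  then have "{b \<in> staircase_shape n. T b = Some s} = {b. T b = Some s}"
    by (metis option.distinct(1))
  then show ?thesis by (simp add: symbol_count_def)
qed

lemma finite_staircase_shape: "finite (staircase_shape n)"
  by (rule finite_subset[of _ "{..n} \<times> {..n}"]) (auto simp: staircase_shape_def)

lemma symbol_count_add_column:
  assumes T: "T \<in> ab_staircase_tableaux n" and c: "c \<in> first_columns n T"
  shows "symbol_count (Suc n) s (add_column c T) =
    card {i \<in> insert (Suc n) (free_rows n T). c i = Some s} + symbol_count n s T"
proof -
  let ?F = "insert (Suc n) (free_rows n T)"
  let ?A = "(\<lambda>i. (i, Suc 0)) ` {i \<in> ?F. c i = Some s}"
  let ?B = "(\<lambda>(i, j). (i, Suc j)) ` {b. T b = Some s}"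
  have cF: "i \<in> ?F" if "c i = Some s" for i
    using c that by (auto simp: first_columns_def column_fillings_def)
  have T0: "T (i, 0) = None" for i
    using T unfolding ab_staircase_tableaux_iff by (metis not_one_le_zero)
  have fin: "finite {b. T b = Some s}"
    by (rule finite_subset[OF _ finite_staircase_shape[of n]])
      (use T in \<open>force simp: ab_staircase_tableaux_def\<close>)
  have "{b. add_column c T b = Some s} = ?A \<union> ?B"
  proof (intro equalityI subsetI)
    fix b assume "b \<in> {b. add_column c T b = Some s}"
    moreover obtain i j where b: "b = (i, j)" by fastforce
    ultimately have a: "add_column c T (i, j) = Some s" by simp
    have "j = 0 \<or> j = Suc 0 \<or> (\<exists>k. j = Suc (Suc k))" by presburger
    then consider "j = Suc 0" "c i = Some s" | k where "j = Suc (Suc k)" "T (i, Suc k) = Some s"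
      using a by auto
    then show "b \<in> ?A \<union> ?B"
    proof cases
      case 1
      then show ?thesis using cF b by auto
    next
      case 2
      then have "b = (\<lambda>(i, j). (i, Suc j)) (i, Suc k)" using b by simp
      then show ?thesis using 2 by blast
    qed
  next
    fix b assume "b \<in> ?A \<union> ?B"
    moreover have "add_column c T (i, Suc j) = Some s" if "T (i, j) = Some s" for i j
      using that T0 by (cases j) auto
    ultimately show "b \<in> {b. add_column c T b = Some s}" by auto
  qed
  moreover have "?A \<inter> ?B = {}"
    using T0 by auto
  moreover have "card ?A = card {i \<in> ?F. c i = Some s}"
    by (rule card_image) (auto intro: inj_onI)
  moreover have "card ?B = card {b. T b = Some s}"
    by (rule card_image) (auto intro: inj_onI)
  ultimately show ?thesis
    unfolding symbol_count_alt[OF T] symbol_count_alt[OF add_column_in_tableaux[OF T c]]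
    using fin by (simp add: card_Un_disjoint)
qed

lemma free_rows_add_column:
  assumes T: "T \<in> ab_staircase_tableaux n"
  shows "free_rows (Suc n) (add_column c T) =
    {i \<in> insert (Suc n) (free_rows n T). c i \<noteq> Some Beta}"
proof -
  have T1: "1 \<le> i \<and> 1 \<le> j \<and> i + j \<le> n + 1" if "T (i, j) = Some s" for i j s
    using T that unfolding ab_staircase_tableaux_iff by blast
  have row: "(\<exists>j. add_column c T (i, j) = Some Beta) \<longleftrightarrow> c i = Some Beta \<or> (\<exists>j. T (i, j) = Some Beta)" for i
  proof
    assume "\<exists>j. add_column c T (i, j) = Some Beta"
    then obtain j where j: "add_column c T (i, j) = Some Beta" ..
    have "j = 0 \<or> j = Suc 0 \<or> (\<exists>k. j = Suc (Suc k))" by presburger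
    with j show "c i = Some Beta \<or> (\<exists>j. T (i, j) = Some Beta)" by auto
  next
    assume "c i = Some Beta \<or> (\<exists>j. T (i, j) = Some Beta)"
    then show "\<exists>j. add_column c T (i, j) = Some Beta"
    proof (elim disjE exE)
      assume "c i = Some Beta"
      then have "add_column c T (i, Suc 0) = Some Beta" by simp
      then show ?thesis ..
    next
      fix j assume j: "T (i, j) = Some Beta"
      then obtain k where "j = Suc k" using T1[OF j] by (cases j) auto
      then have "add_column c T (i, Suc j) = Some Beta" using j by simp
      then show ?thesis ..
    qed
  qed
  \<comment> \<open>The new bottom row has no \<open>Beta\<close> in \<open>T\<close>, so only its
    new box decides whether it is free.\<close>
  have "T (Suc n, j) \<noteq> Some Beta" for j
    using T1[of "Suc n" j Beta] by auto
  with row show ?thesis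
    unfolding free_rows_def by (auto simp: le_Suc_eq)
qed

text \<open>The box \<open>(n - j, j)\<close> moves to \<open>(n - j, Suc j)\<close>, again on the
  second diagonal; the only new box there is \<open>(n, 1)\<close>.\<close>

lemma second_diagonal_alphas_add_column:
  assumes T: "T \<in> ab_staircase_tableaux n" and c: "c \<in> first_columns n T"
  shows "second_diagonal_alphas (Suc n) (add_column c T) =
    second_diagonal_alphas n T + (if c n = Some Alpha then 1 else 0)"
proof (cases n)
  case 0
  \<comment> \<open>For size 0 there is no new diagonal box, and row 0 is not admissible, so
    \<open>c 0\<close> is \<open>None\<close>.\<close>
  then show ?thesis
    using c by (auto simp: second_diagonal_alphas_def first_columns_def column_fillings_def free_rows_def)
next
  case (Suc m)
  have "second_diagonal_alphas (Suc n) (add_column c T) =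
      (if c n = Some Alpha then 1 else 0) +
      (\<Sum>j=Suc 1..<Suc n. if add_column c T (Suc n - j, j) = Some Alpha then 1 else 0)"
    unfolding second_diagonal_alphas_def using Suc by (subst sum.atLeast_Suc_lessThan) simp_all
  also have "(\<Sum>j=Suc 1..<Suc n. if add_column c T (Suc n - j, j) = Some Alpha then 1 else 0) =
      (\<Sum>j=1..<n. if add_column c T (Suc n - Suc j, Suc j) = Some Alpha then 1 else (0::nat))"
    by (rule sum.shift_bounds_Suc_ivl)
  also have "\<dots> = second_diagonal_alphas n T"
    unfolding second_diagonal_alphas_def
  proof (rule sum.cong[OF refl])
    fix j assume "j \<in> {1..<n}"
    then obtain k where "j = Suc k" by (cases j) auto
    then show "(if add_column c T (Suc n - Suc j, Suc j) = Some Alpha then 1 else (0::nat)) =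
        (if T (n - j, j) = Some Alpha then 1 else 0)" by simp
  qed
  finally show ?thesis by simp
qed

section \<open>Recurrence for the generating functions\<close>

definition refined_weight :: "nat \<Rightarrow> 'a::comm_ring_1 \<Rightarrow> 'a \<Rightarrow> 'a \<Rightarrow> 'a \<Rightarrow> filling \<Rightarrow> 'a" where
  "refined_weight n u v t x T = u ^ symbol_count n Alpha T * v ^ symbol_count n Beta T
     * t ^ second_diagonal_alphas n T * x ^ card (free_rows n T)"

definition tableau_gf :: "nat \<Rightarrow> 'a::comm_ring_1 \<Rightarrow> 'a \<Rightarrow> 'a \<Rightarrow> 'a \<Rightarrow> 'a" where
  "tableau_gf n u v t x = (\<Sum>T\<in>ab_staircase_tableaux n. refined_weight n u v t x T)"

text \<open>An \<open>Alpha\<close> in the new second-diagonal box requires row \<open>n\<close> to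
  be free; the correction term of \<open>sum_columns\<close> occurs for exactly these
  tableaux.\<close>

definition free_bottom_gf :: "nat \<Rightarrow> 'a::comm_ring_1 \<Rightarrow> 'a \<Rightarrow> 'a \<Rightarrow> 'a \<Rightarrow> 'a" where
  "free_bottom_gf n u v t x =
     (\<Sum>T\<in>ab_staircase_tableaux n. if n \<in> free_rows n T then refined_weight n u v t x T else 0)"

text \<open>On the right \<open>T\<close> is weighted at \<open>x = 1\<close>, since the entry
  weights of the new column recount all rows that remain free.\<close>

lemma refined_weight_add_column:
  assumes T: "T \<in> ab_staircase_tableaux n" and c: "c \<in> first_columns n T"
  shows "refined_weight (Suc n) u v t x (add_column c T) = refined_weight n u v t 1 T *
    ((\<Prod>i\<in>insert (Suc n) (free_rows n T). entry_weight u v x (c i)) * (if c n = Some Alpha then t else 1))"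
  unfolding refined_weight_def symbol_count_add_column[OF T c] free_rows_add_column[OF T]
    second_diagonal_alphas_add_column[OF T c]
  by (subst prod_entry_weight) (simp_all add: power_add)

lemma refined_weight_x: "refined_weight n u v t x T = refined_weight n u v t 1 T * x ^ card (free_rows n T)"
  by (simp add: refined_weight_def)

lemma finite_first_columns: "finite (first_columns n T)"
  unfolding first_columns_def
  by (rule finite_subset[OF _ finite_column_fillings[of "insert (Suc n) (free_rows n T)"]]) auto

lemma sum_ab_staircase_tableaux_Suc:
  "(\<Sum>S\<in>ab_staircase_tableaux (Suc n). g S) =
    (\<Sum>T\<in>ab_staircase_tableaux n. \<Sum>c\<in>first_columns n T. g (add_column c T))"
  unfolding ab_staircase_tableaux_Suc
  by (subst sum.reindex[OF inj_on_add_column], subst sum.Sigma)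
    (auto simp: finite_ab_staircase_tableaux finite_first_columns case_prod_beta')

text \<open>In the plain column sum each free row of \<open>T\<close> contributes
  \<open>x + v\<close>, which shifts the argument; in the correction for \<open>t\<close> it
  contributes \<open>x\<close>.\<close>

lemma tableau_gf_Suc:
  "tableau_gf (Suc n) u v t x =
    (u * x + v) * tableau_gf n u v t (x + v) + (t - 1) * u * v * free_bottom_gf n u v t x"
proof -
  have le: "\<forall>i\<in>free_rows n T. i \<le> n" for T
    by (auto simp: free_rows_def)
  have "tableau_gf (Suc n) u v t x = (\<Sum>T\<in>ab_staircase_tableaux n. refined_weight n u v t 1 T *
      (\<Sum>c\<in>first_columns n T. (\<Prod>i\<in>insert (Suc n) (free_rows n T). entry_weight u v x (c i))
        * (if c n = Some Alpha then t else 1)))"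
    unfolding tableau_gf_def sum_ab_staircase_tableaux_Suc sum_distrib_left
    by (intro sum.cong refl refined_weight_add_column)
  also have "\<dots> = (\<Sum>T\<in>ab_staircase_tableaux n. refined_weight n u v t 1 T *
      ((u * x + v) * (x + v) ^ card (free_rows n T)
        + (if n \<in> free_rows n T then (t - 1) * u * v * x ^ card (free_rows n T) else 0)))"
    unfolding first_columns_def by (subst sum_columns) (auto simp: le)
  also have "\<dots> = (\<Sum>T\<in>ab_staircase_tableaux n. (u * x + v) * refined_weight n u v t (x + v) T +
      (t - 1) * u * v * (if n \<in> free_rows n T then refined_weight n u v t x T else 0))"
    unfolding refined_weight_x[of n u v t "x + v"] refined_weight_x[of n u v t x]
    by (intro sum.cong refl) (simp add: algebra_simps)
  finally show ?thesis
    by (simp add: tableau_gf_def free_bottom_gf_def sum.distrib sum_distrib_left)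
qed

text \<open>The bottom row has a single box and is free iff this box holds \<open>Alpha\<close>.
  Then the rest of the new column is empty, so no second-diagonal \<open>Alpha\<close> is gained and
  all free rows stay free. This closes the recurrence at order two.\<close>

lemma free_bottom_gf_Suc: "free_bottom_gf (Suc n) u v t x = u * x * tableau_gf n u v t x"
proof -
  have inner: "(\<Sum>c\<in>first_columns n T. if Suc n \<in> free_rows (Suc n) (add_column c T)
        then refined_weight (Suc n) u v t x (add_column c T) else 0)
      = u * x * refined_weight n u v t x T" (is "?L = _") if T: "T \<in> ab_staircase_tableaux n" for T
  proof -
    let ?F = "free_rows n T"
    have lt: "\<forall>i\<in>?F. i < Suc n" and m: "Suc n \<notin> ?F"
      by (auto simp: free_rows_def)
    have "?L = (\<Sum>c\<in>first_columns n T. if c (Suc n) = Some Beta then 0 else refined_weight n u v t 1 T *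
      ((\<Prod>i\<in>insert (Suc n) ?F. entry_weight u v x (c i)) * (if c n = Some Alpha then t else 1)))"
      using T by (intro sum.cong refl) (auto simp: free_rows_add_column refined_weight_add_column)
    also have "\<dots> = refined_weight n u v t 1 T * (u * x * x ^ card ?F)"
      unfolding first_columns_def sum_nonempty_bottom[OF finite_free_rows lt]
        prod_entry_weight_upd[OF finite_free_rows m]
      by simp
    finally show ?thesis
      unfolding refined_weight_x[of n u v t x] by (simp add: algebra_simps)
  qed
  show ?thesis
    unfolding free_bottom_gf_def tableau_gf_def sum_ab_staircase_tableaux_Suc sum_distrib_left
    by (intro sum.cong refl inner)
qed

lemma ab_staircase_tableaux_0: "ab_staircase_tableaux 0 = {\<lambda>_. None}"
proof -
  have "staircase_shape 0 = {}" by (auto simp: staircase_shape_def)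
  then show ?thesis by (auto simp: ab_staircase_tableaux_def)
qed

lemma free_rows_0: "free_rows 0 T = {}"
  by (auto simp: free_rows_def)

lemma tableau_gf_0: "tableau_gf 0 u v t x = 1"
  by (simp add: tableau_gf_def ab_staircase_tableaux_0 refined_weight_def free_rows_0
      symbol_count_def second_diagonal_alphas_def)

lemma free_bottom_gf_0: "free_bottom_gf 0 u v t x = 0"
  by (simp add: free_bottom_gf_def free_rows_0)

section \<open>Complete homogeneous symmetric polynomials in consecutive numbers\<close>

text \<open>
  \<open>consecutive_h k m y\<close> is the complete homogeneous symmetric polynomial of degree \<open>k\<close> in the \<open>m\<close>
  variables \<open>y, \<dots>, y + m - 1\<close>; the recursion splits off the last variable.
\<close>

fun consecutive_h :: "nat \<Rightarrow> nat \<Rightarrow> real \<Rightarrow> real" where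
  "consecutive_h 0 m y = 1"
| "consecutive_h (Suc k) 0 y = 0"
| "consecutive_h (Suc k) (Suc m) y = consecutive_h (Suc k) m y + (y + real m) * consecutive_h k (Suc m) y"

text \<open>By symmetry the first variable can be split off instead of the last. This form matches
  the shift of \<open>y\<close> to \<open>y + 1\<close> when a column is added.\<close>

lemma consecutive_h_rec_first:
  "consecutive_h (Suc k) (Suc m) y = consecutive_h (Suc k) m (y + 1) + y * consecutive_h k (Suc m) y"
proof (induction k arbitrary: m)
  case 0
  show ?case by (induction m) (auto simp: algebra_simps)
next
  case (Suc k)
  note k = Suc.IH
  show ?case
  proof (induction m)
    case 0
    show ?case by simp
  next
    case (Suc m)
    have "consecutive_h (Suc (Suc k)) (Suc (Suc m)) y =
        consecutive_h (Suc (Suc k)) (Suc m) y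
          + (y + real (Suc m)) * consecutive_h (Suc k) (Suc (Suc m)) y"
      by (rule consecutive_h.simps)
    also have "\<dots> = consecutive_h (Suc (Suc k)) m (y + 1) + y * consecutive_h (Suc k) (Suc m) y
        + (y + real (Suc m)) * (consecutive_h (Suc k) (Suc m) (y + 1) + y * consecutive_h k (Suc (Suc m)) y)"
      by (simp only: Suc.IH k)
    also have "\<dots> = consecutive_h (Suc (Suc k)) (Suc m) (y + 1)
        + y * consecutive_h (Suc k) (Suc (Suc m)) y"
      by (simp only: consecutive_h.simps) (simp add: algebra_simps)
    finally show ?case .
  qed
qed

lemma consecutive_h_nonneg: "y \<ge> 0 \<Longrightarrow> consecutive_h k m y \<ge> 0"
  by (induction k m y rule: consecutive_h.induct) auto

text \<open>There are \<open>pochhammer (real (Suc m)) k / fact k\<close> monomials, each at most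
  \<open>(y + real m) ^ k\<close>.\<close>

lemma consecutive_h_le:
  assumes y: "y \<ge> 0"
  shows "fact k * consecutive_h k (Suc m) y \<le> pochhammer (real (Suc m)) k * (y + real m) ^ k"
proof (induction k arbitrary: m)
  case 0
  show ?case by simp
next
  case (Suc k)
  note k = Suc.IH
  have step: "(real k + 1) * (y + real m) * (fact k * consecutive_h k (Suc m) y)
      \<le> (real k + 1) * (y + real m) * (pochhammer (real (Suc m)) k * (y + real m) ^ k)" for m
    using y k by (intro mult_left_mono) auto
  show ?case
  proof (induction m)
    case 0
    have "fact (Suc k) * consecutive_h (Suc k) (Suc 0) y
        \<le> (real k + 1) * y * (pochhammer 1 k * y ^ k)"
      using step[of 0] by (simp add: algebra_simps)
    then show ?case
      by (simp add: pochhammer_Suc algebra_simps)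
  next
    case (Suc m)
    let ?z = "y + real (Suc m)"
    have "fact (Suc k) * consecutive_h (Suc k) (Suc (Suc m)) y =
        fact (Suc k) * consecutive_h (Suc k) (Suc m) y
          + (real k + 1) * ?z * (fact k * consecutive_h k (Suc (Suc m)) y)"
      by (simp only: consecutive_h.simps fact_Suc) (simp add: algebra_simps)
    also have "\<dots> \<le> pochhammer (real (Suc m)) (Suc k) * ?z ^ Suc k
          + (real k + 1) * ?z * (pochhammer (real (Suc (Suc m))) k * ?z ^ k)"
    proof (rule add_mono)
      have "(y + real m) ^ Suc k \<le> ?z ^ Suc k"
        using y by (intro power_mono) auto
      then have "pochhammer (real (Suc m)) (Suc k) * (y + real m) ^ Suc k
          \<le> pochhammer (real (Suc m)) (Suc k) * ?z ^ Suc k"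
        by (intro mult_left_mono pochhammer_nonneg) auto
      with Suc.IH show "fact (Suc k) * consecutive_h (Suc k) (Suc m) y
          \<le> pochhammer (real (Suc m)) (Suc k) * ?z ^ Suc k"
        by (rule order_trans)
    qed (rule step)
    also have "\<dots> = (pochhammer (real (Suc m)) (Suc k)
        + (real k + 1) * pochhammer (real (Suc (Suc m))) k) * ?z ^ Suc k"
      by (simp add: algebra_simps)
    \<comment> \<open>Pascal's rule for the number of monomials: after the common factor is taken
      out, \<open>(m + 1) + (k + 1)\<close> is the last factor \<open>m + 2 + k\<close>.\<close>
    also have "pochhammer (real (Suc m)) (Suc k) = real (Suc m) * pochhammer (real (Suc (Suc m))) k"
      using pochhammer_rec[of "real (Suc m)" k] by (simp add: add.commute)
    also have "real (Suc m) * pochhammer (real (Suc (Suc m))) k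
        + (real k + 1) * pochhammer (real (Suc (Suc m))) k = pochhammer (real (Suc (Suc m))) (Suc k)"
      unfolding pochhammer_Suc by (simp add: algebra_simps)
    finally show ?case .
  qed
qed

section \<open>Asymptotics by the Stolz-Cesaro theorem\<close>

lemma stolz_cesaro:
  fixes a b :: "nat \<Rightarrow> real"
  assumes mono: "\<And>n. b n < b (Suc n)"
    and b: "filterlim b at_top sequentially"
    and lim: "(\<lambda>n. (a (Suc n) - a n) / (b (Suc n) - b n)) \<longlonglongrightarrow> L"
  shows "(\<lambda>n. a n / b n) \<longlonglongrightarrow> L"
proof (rule LIMSEQ_I)
  fix e :: real assume e: "e > 0"
  \<comment> \<open>Subtracting \<open>L * b n\<close> reduces the claim to
    \<open>d n = o(b n)\<close>, which follows by telescoping the small increments.\<close>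
  define d where "d n = a n - L * b n" for n
  have "\<forall>\<^sub>F n in sequentially. dist ((a (Suc n) - a n) / (b (Suc n) - b n)) L < e / 2"
    using lim e by (intro tendstoD) auto
  then obtain N where N: "\<And>n. n \<ge> N \<Longrightarrow> \<bar>(a (Suc n) - a n) / (b (Suc n) - b n) - L\<bar> < e / 2"
    unfolding eventually_sequentially dist_real_def by blast
  have d: "\<bar>d (Suc n) - d n\<bar> \<le> e / 2 * (b (Suc n) - b n)" if "n \<ge> N" for n
  proof -
    have pos: "b (Suc n) - b n > 0" using mono[of n] by simp
    have "d (Suc n) - d n = ((a (Suc n) - a n) / (b (Suc n) - b n) - L) * (b (Suc n) - b n)"
      using pos by (simp add: d_def field_simps)
    then have "\<bar>d (Suc n) - d n\<bar> = \<bar>(a (Suc n) - a n) / (b (Suc n) - b n) - L\<bar> * (b (Suc n) - b n)"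
      using pos by (simp add: abs_mult)
    also have "\<dots> \<le> e / 2 * (b (Suc n) - b n)"
      using N[OF that] pos by (intro mult_right_mono) auto
    finally show ?thesis .
  qed
  have sum: "\<bar>d n - d N\<bar> \<le> e / 2 * (b n - b N)" if "n \<ge> N" for n
    using that
  proof (induction n rule: dec_induct)
    case (step n)
    have "\<bar>d (Suc n) - d N\<bar> \<le> \<bar>d (Suc n) - d n\<bar> + \<bar>d n - d N\<bar>" by linarith
    with step.IH d[OF step.hyps(1)] show ?case by (simp add: algebra_simps)
  qed simp
  \<comment> \<open>Beyond this threshold the contribution of the starting index \<open>N\<close> is
    below \<open>e / 2 * b n\<close>, and \<open>b n\<close> is positive.\<close>
  have "\<forall>\<^sub>F n in sequentially. b n > max 1 ((\<bar>d N\<bar> + e / 2 * \<bar>b N\<bar>) * (2 / e))"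
    using b unfolding filterlim_at_top_dense by blast
  then obtain K where K: "\<And>n. n \<ge> K \<Longrightarrow> b n > max 1 ((\<bar>d N\<bar> + e / 2 * \<bar>b N\<bar>) * (2 / e))"
    unfolding eventually_sequentially by blast
  show "\<exists>no. \<forall>n\<ge>no. norm (a n / b n - L) < e"
  proof (intro exI allI impI)
    fix n assume n: "n \<ge> max N K"
    then have bn: "b n > 1" "b n > (\<bar>d N\<bar> + e / 2 * \<bar>b N\<bar>) * (2 / e)"
      using K[of n] by auto
    have "\<bar>d n\<bar> \<le> \<bar>d N\<bar> + e / 2 * (b n - b N)" using sum[of n] n by linarith
    also have "\<dots> \<le> (\<bar>d N\<bar> + e / 2 * \<bar>b N\<bar>) + e / 2 * b n"
    proof -
      have "e / 2 * (- b N) \<le> e / 2 * \<bar>b N\<bar>" using e by (intro mult_left_mono) auto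
      then show ?thesis by (simp add: algebra_simps)
    qed
    also have "\<dots> < e / 2 * b n + e / 2 * b n"
      using bn(2) e by (simp add: field_simps)
    finally have "\<bar>d n\<bar> < e * b n" by simp
    moreover have "a n / b n - L = d n / b n"
      using bn by (simp add: d_def field_simps)
    ultimately show "norm (a n / b n - L) < e"
      using bn by (simp add: field_simps)
  qed
qed

text \<open>Both products share the factor \<open>pochhammer (x + 1) j\<close>; the remaining
  factors differ by \<open>j + 1\<close>.\<close>

lemma pochhammer_shift_diff:
  "pochhammer (x + 1) (Suc j) - pochhammer x (Suc j) = (of_nat j + 1) * pochhammer (x + 1) j"
  for x :: "'a::comm_ring_1"
  unfolding pochhammer_rec[of x] pochhammer_Suc[of "x + 1"] by (simp add: algebra_simps)

text \<open>Induction on the degree by Stolz-Cesaro. The numerator grows by its last variable times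
  the polynomial of degree \<open>k\<close>, the denominator by \<open>2 * k + 2\<close> times a
  rising factorial of length \<open>2 * k + 1\<close>; so each degree contributes the factor
  \<open>1 / (2 * (k + 1))\<close> to the limit.\<close>

lemma consecutive_h_asymp:
  assumes y: "y \<ge> 0" and z: "z > 0"
  shows "(\<lambda>m. consecutive_h k (Suc m) y / pochhammer (real m + z) (2 * k)) \<longlonglongrightarrow> 1 / (2 ^ k * fact k)"
proof (induction k)
  case 0
  show ?case by simp
next
  case (Suc k)
  let ?b = "\<lambda>m. pochhammer (real m + z) (2 * Suc k)"
  let ?j = "Suc (2 * k)"
  have diff: "?b (Suc m) - ?b m = (real (2 * k) + 2) * pochhammer (real (Suc m) + z) ?j" for m
    using pochhammer_shift_diff[of "real m + z" ?j] by (simp add: ac_simps)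
  have pos: "pochhammer (real m + z) j > 0" for m j
    using z by (intro pochhammer_pos) auto
  show ?case
  proof (rule stolz_cesaro)
    show "?b m < ?b (Suc m)" for m
    proof -
      have "(real (2 * k) + 2) * pochhammer (real (Suc m) + z) ?j > 0"
        by (intro mult_pos_pos pos) auto
      then show ?thesis using diff[of m] by linarith
    qed
    \<comment> \<open>The first two factors have product at least \<open>real m * z\<close>, and the
      other \<open>2 * k\<close> have product at least 1 once \<open>m \<ge> 1\<close>.\<close>
    show "filterlim ?b at_top sequentially"
    proof (rule filterlim_at_top_mono)
      show "filterlim (\<lambda>m. real m * z) at_top sequentially"
        using z by real_asymp
      show "\<forall>\<^sub>F m in sequentially. real m * z \<le> ?b m"
      proof (rule eventually_mono[OF eventually_ge_at_top[of 1]])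
        fix m :: nat assume m: "m \<ge> 1"
        have one: "1 \<le> pochhammer (real m + z + 2) (2 * k)"
          using m z by (simp add: pochhammer_prod) (intro prod_ge_1, auto)
        have "?b m = (real m + z) * (real m + z + 1) * pochhammer (real m + z + 2) (2 * k)"
          by (simp add: pochhammer_rec algebra_simps)
        moreover have "(real m + z) * (real m + z + 1) \<ge> real m * z"
          using z by (simp add: algebra_simps)
        moreover have "(real m + z) * (real m + z + 1) * 1 \<le>
            (real m + z) * (real m + z + 1) * pochhammer (real m + z + 2) (2 * k)"
          using one z by (intro mult_left_mono) auto
        ultimately show "real m * z \<le> ?b m" by linarith
      qed
    qed
    have "(\<lambda>m. consecutive_h k (Suc (Suc m)) y / pochhammer (real (Suc m) + z) (2 * k) *
        ((y + real (Suc m)) / ((2 * real k + 2) * (real (Suc m) + z + 2 * real k))))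
        \<longlonglongrightarrow> 1 / (2 ^ k * fact k) * (1 / (2 * real k + 2))"
    proof (rule tendsto_mult)
      show "(\<lambda>m. consecutive_h k (Suc (Suc m)) y / pochhammer (real (Suc m) + z) (2 * k))
          \<longlonglongrightarrow> 1 / (2 ^ k * fact k)"
        using LIMSEQ_Suc[OF Suc.IH] by simp
      have "real k \<ge> 0" by simp
      then show "(\<lambda>m. (y + real (Suc m)) / ((2 * real k + 2) * (real (Suc m) + z + 2 * real k)))
          \<longlonglongrightarrow> 1 / (2 * real k + 2)"
        by real_asymp (simp add: divide_inverse)
    qed
    moreover have eq: "(consecutive_h (Suc k) (Suc (Suc m)) y - consecutive_h (Suc k) (Suc m) y) / (?b (Suc m) - ?b m) =
        consecutive_h k (Suc (Suc m)) y / pochhammer (real (Suc m) + z) (2 * k) *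
        ((y + real (Suc m)) / ((2 * real k + 2) * (real (Suc m) + z + 2 * real k)))" for m
      unfolding diff by (simp add: pochhammer_Suc mult_ac)
    moreover have "1 / (2 ^ k * fact k) * (1 / (2 * real k + 2)) = 1 / (2 ^ Suc k * fact (Suc k))"
      by (simp add: field_simps)
    ultimately show "(\<lambda>m. (consecutive_h (Suc k) (Suc (Suc m)) y - consecutive_h (Suc k) (Suc m) y) / (?b (Suc m) - ?b m))
        \<longlonglongrightarrow> 1 / (2 ^ Suc k * fact (Suc k))"
      by (simp only: eq)
  qed
qed

section \<open>Binomial moments and the Poisson limit\<close>

text \<open>
  The coefficient of \<open>(t - 1)\<^sup>k\<close> in the generating function; after division by the total weight it is
  the \<open>k\<close>-th binomial moment of the number of \<open>\<alpha>\<close>'s on the second diagonal.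
\<close>

definition alpha_moment :: "nat \<Rightarrow> nat \<Rightarrow> real \<Rightarrow> real \<Rightarrow> real" where
  "alpha_moment n k a y = (if 2 * k \<le> n
     then pochhammer (y + a) (n - 2 * k) * consecutive_h k (n + 1 - 2 * k) y else 0)"

lemma alpha_moment_0 [simp]: "alpha_moment n 0 a y = pochhammer (y + a) n"
  by (simp add: alpha_moment_def)

text \<open>In the generic case \<open>y + a\<close> completes the shifted rising factorial to one
  of length \<open>Suc d\<close>; with this common factor removed, the first variable is split
  off.\<close>

lemma alpha_moment_rec:
  "alpha_moment (Suc (Suc n)) (Suc k) a y =
    (y + a) * alpha_moment (Suc n) (Suc k) a (y + 1) + y * alpha_moment n k a y"
proof -
  \<comment> \<open>For \<open>n < 2 * k\<close> all terms vanish; for \<open>n = 2 * k\<close> the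
    shifted term does, as \<open>2 * Suc k > Suc n\<close>.\<close>
  consider "n < 2 * k" | "n = 2 * k" | d where "n = 2 * k + Suc d"
    by (metis add_Suc_right less_imp_Suc_add linorder_neqE_nat)
  then show ?thesis
  proof cases
    case 3
    then have "alpha_moment (Suc (Suc n)) (Suc k) a y =
        pochhammer (y + a) (Suc d) * consecutive_h (Suc k) (Suc (Suc d)) y"
      and "alpha_moment (Suc n) (Suc k) a (y + 1) =
        pochhammer (y + 1 + a) d * consecutive_h (Suc k) (Suc d) (y + 1)"
      and "alpha_moment n k a y = pochhammer (y + a) (Suc d) * consecutive_h k (Suc (Suc d)) y"
      by (simp_all add: alpha_moment_def Suc_diff_le)
    then show ?thesis
      unfolding consecutive_h_rec_first[of k "Suc d"] pochhammer_rec[of "y + a"]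
      by (simp add: algebra_simps)
  qed (simp_all add: alpha_moment_def consecutive_h_rec_first[of k 0] del: consecutive_h.simps(3))
qed

lemma alpha_moment_eq_0: "n < 2 * k \<Longrightarrow> alpha_moment n k a y = 0"
  by (simp add: alpha_moment_def)

text \<open>Both sides satisfy the same recurrence of order two. With \<open>x = v * y\<close>, the
  shift \<open>x + v\<close> becomes \<open>y + 1\<close>, so \<open>y\<close> varies in the
  induction, and \<open>u * x + v\<close> becomes \<open>u * v * (y + 1 / u)\<close>.\<close>

lemma tableau_gf_eq:
  assumes uv: "u \<noteq> 0" "v \<noteq> 0"
  shows "tableau_gf n (complex_of_real u) (complex_of_real v) t (complex_of_real (v * y)) =
    of_real ((u * v) ^ n) * (\<Sum>k\<le>n. (t - 1) ^ k * of_real (alpha_moment n k (1 / u) y))"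
proof (induction n arbitrary: y rule: induct_nat_012)
  case 0
  show ?case by (simp add: tableau_gf_0)
next
  case 1
  then show ?case
    using uv by (simp add: tableau_gf_Suc tableau_gf_0 free_bottom_gf_0 alpha_moment_eq_0 field_simps)
next
  case (ge2 n)
  let ?m = "\<lambda>n k y. complex_of_real (alpha_moment n k (1 / u) y)"
  let ?s = "t - 1"
  let ?S = "\<lambda>n y. \<Sum>k\<le>n. ?s ^ k * ?m n k y"
  have shift: "?S (Suc n) (y + 1) = ?m (Suc n) 0 (y + 1) + (\<Sum>k\<le>n. ?s ^ Suc k * ?m (Suc n) (Suc k) (y + 1))"
    by (subst sum.atMost_Suc_shift) simp
  have "?S (Suc (Suc n)) y = ?m (Suc (Suc n)) 0 y
      + (\<Sum>k\<le>Suc n. ?s ^ Suc k * ?m (Suc (Suc n)) (Suc k) y)"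
    by (subst sum.atMost_Suc_shift) simp
  \<comment> \<open>The summand \<open>k = Suc n\<close> is zero, since its moment index exceeds
    half the size.\<close>
  also have "(\<Sum>k\<le>Suc n. ?s ^ Suc k * ?m (Suc (Suc n)) (Suc k) y) =
      (\<Sum>k\<le>n. ?s ^ Suc k * ?m (Suc (Suc n)) (Suc k) y)"
    by (simp add: alpha_moment_eq_0)
  also have "\<dots> = (\<Sum>k\<le>n. of_real (y + 1 / u) * (?s ^ Suc k * ?m (Suc n) (Suc k) (y + 1))
      + ?s * of_real y * (?s ^ k * ?m n k y))"
    unfolding alpha_moment_rec by (intro sum.cong refl) (simp add: distrib_left distrib_right mult_ac)
  also have "\<dots> = of_real (y + 1 / u) * (\<Sum>k\<le>n. ?s ^ Suc k * ?m (Suc n) (Suc k) (y + 1))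
      + ?s * of_real y * ?S n y"
    by (simp add: sum.distrib sum_distrib_left)
  also have "?m (Suc (Suc n)) 0 y = of_real (y + 1 / u) * ?m (Suc n) 0 (y + 1)"
    by (simp add: pochhammer_rec[of "y + 1 / u"] add_ac)
  finally have S: "?S (Suc (Suc n)) y = of_real (y + 1 / u) * ?S (Suc n) (y + 1) + ?s * of_real y * ?S n y"
    unfolding shift by (simp only: distrib_left add.assoc)
  have "tableau_gf (Suc (Suc n)) (complex_of_real u) (complex_of_real v) t (complex_of_real (v * y)) =
      (u * of_real (v * y) + v) * tableau_gf (Suc n) u v t (of_real (v * (y + 1)))
      + ?s * u * v * (u * of_real (v * y) * tableau_gf n u v t (of_real (v * y)))"
    unfolding tableau_gf_Suc[of "Suc n"] free_bottom_gf_Suc by (simp add: algebra_simps)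
  also have "\<dots> = of_real ((u * v) ^ Suc (Suc n)) * (of_real (y + 1 / u) * ?S (Suc n) (y + 1) + ?s * of_real y * ?S n y)"
    unfolding ge2 using uv by (simp add: field_simps)
  finally show ?case
    unfolding S .
qed

text \<open>Taking \<open>t = 1\<close> leaves only the term \<open>k = 0\<close>, and
  \<open>y = 1 / \<beta>\<close> means \<open>x = 1\<close>.\<close>

lemma sum_tableau_weight:
  assumes "\<alpha> \<noteq> 0" "\<beta> \<noteq> 0"
  shows "(\<Sum>T\<in>ab_staircase_tableaux n. tableau_weight n \<alpha> \<beta> T) =
    (\<alpha> * \<beta>) ^ n * pochhammer (1 / \<beta> + 1 / \<alpha>) n"
proof -
  have "complex_of_real (\<Sum>T\<in>ab_staircase_tableaux n. tableau_weight n \<alpha> \<beta> T) =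
      tableau_gf n (complex_of_real \<alpha>) (complex_of_real \<beta>) 1 (complex_of_real (\<beta> * (1 / \<beta>)))"
    using assms(2) by (simp add: tableau_gf_def refined_weight_def tableau_weight_def)
  also have "\<dots> = of_real ((\<alpha> * \<beta>) ^ n * pochhammer (1 / \<beta> + 1 / \<alpha>) n)"
    unfolding tableau_gf_eq[OF assms] by (simp add: sum.atMost_shift)
  finally show ?thesis
    by (simp only: of_real_eq_iff)
qed

definition normalized_moment :: "nat \<Rightarrow> nat \<Rightarrow> real \<Rightarrow> real \<Rightarrow> real" where
  "normalized_moment n k a y = alpha_moment n k a y / pochhammer (y + a) n"

lemma normalized_moment_eq:
  assumes "y > 0" "a > 0"
  shows "normalized_moment (2 * k + d) k a y =
    consecutive_h k (Suc d) y / pochhammer (real d + (y + a)) (2 * k)"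
proof -
  have "pochhammer (y + a) (d + 2 * k) = pochhammer (y + a) d * pochhammer (y + a + real d) (2 * k)"
    by (rule pochhammer_product')
  moreover have "pochhammer (y + a) d > 0"
    using assms by (intro pochhammer_pos) auto
  ultimately show ?thesis
    by (simp add: normalized_moment_def alpha_moment_def add_ac)
qed

lemma pochhammer_mono:
  fixes x y :: real
  assumes "0 \<le> x" "x \<le> y"
  shows "pochhammer x n \<le> pochhammer y n"
  unfolding pochhammer_prod using assms by (intro prod_mono) auto

lemma power_le_pochhammer:
  fixes x :: real
  assumes "0 \<le> x"
  shows "x ^ n \<le> pochhammer x n"
proof -
  have "(\<Prod>i=0..<n. x) \<le> pochhammer x n"
    unfolding pochhammer_prod using assms by (intro prod_mono) auto
  then show ?thesis by simp
qed

text \<open>The bound is uniform in \<open>n\<close>, so it can dominate the series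
  termwise.\<close>

lemma normalized_moment_bounds:
  assumes "y > 0" "a > 0"
  shows "0 \<le> normalized_moment n k a y" "normalized_moment n k a y \<le> 1 / fact k"
proof -
  have "0 \<le> normalized_moment n k a y \<and> normalized_moment n k a y \<le> 1 / fact k"
  proof (cases "2 * k \<le> n")
    case False
    then show ?thesis by (simp add: normalized_moment_def alpha_moment_eq_0)
  next
    case True
    then obtain d where n: "n = 2 * k + d" using le_Suc_ex by blast
    let ?w = "y + a + real d"
    have pos: "pochhammer ?w (2 * k) > 0"
      using assms by (intro pochhammer_pos) auto
    have eq: "normalized_moment n k a y = consecutive_h k (Suc d) y / pochhammer ?w (2 * k)"
      unfolding n normalized_moment_eq[OF assms] by (simp add: add_ac)
    have "fact k * consecutive_h k (Suc d) y \<le> pochhammer (real (Suc d)) k * (y + real d) ^ k"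
      using assms by (intro consecutive_h_le) auto
    \<comment> \<open>The denominator has \<open>2 * k\<close> factors: the upper half dominates the
      rising factorial, the lower half the power.\<close>
    also have "\<dots> \<le> pochhammer (?w + real k) k * pochhammer ?w k"
    proof (rule mult_mono)
      show "pochhammer (real (Suc d)) k \<le> pochhammer (?w + real k) k"
        \<comment> \<open>For \<open>k > 0\<close> the base \<open>?w + real k\<close> is at least
          \<open>d + 1\<close>; for \<open>k = 0\<close> both products are empty.\<close>
        using assms by (cases k) (auto intro: pochhammer_mono simp del: pochhammer_Suc)
      have "(y + real d) ^ k \<le> ?w ^ k"
        using assms by (intro power_mono) auto
      also have "\<dots> \<le> pochhammer ?w k"
        using assms by (intro power_le_pochhammer) auto
      finally show "(y + real d) ^ k \<le> pochhammer ?w k" .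
    qed (use assms in \<open>auto intro!: pochhammer_nonneg\<close>)
    also have "\<dots> = pochhammer ?w (2 * k)"
      using pochhammer_product'[of ?w k k] by (simp add: mult_2)
    finally have "consecutive_h k (Suc d) y / pochhammer ?w (2 * k) \<le> 1 / fact k"
      using pos by (simp add: field_simps)
    moreover have "consecutive_h k (Suc d) y / pochhammer ?w (2 * k) \<ge> 0"
      using pos consecutive_h_nonneg[of y] assms by (intro divide_nonneg_pos) auto
    ultimately show ?thesis
      unfolding eq by blast
  qed
  then show "0 \<le> normalized_moment n k a y" "normalized_moment n k a y \<le> 1 / fact k" by auto
qed

lemma normalized_moment_tendsto:
  assumes "y > 0" "a > 0"
  shows "(\<lambda>n. normalized_moment n k a y) \<longlonglongrightarrow> 1 / (2 ^ k * fact k)"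
proof -
  have "(\<lambda>d. consecutive_h k (Suc d) y / pochhammer (real d + (y + a)) (2 * k))
      \<longlonglongrightarrow> 1 / (2 ^ k * fact k)"
    using assms by (intro consecutive_h_asymp) auto
  then have "(\<lambda>d. normalized_moment (d + 2 * k) k a y) \<longlonglongrightarrow> 1 / (2 ^ k * fact k)"
    using normalized_moment_eq[OF assms] by (simp add: add.commute)
  then show ?thesis
    by (rule LIMSEQ_offset)
qed

section \<open>Probability generating functions and convergence in distribution\<close>

lemma random_ab_tableau_pgf:
  assumes "\<alpha> > 0" "\<beta> > 0"
  shows "measure_pmf.expectation (random_ab_tableau n \<alpha> \<beta>) (\<lambda>T. (t::complex) ^ second_diagonal_alphas n T) =
    (\<Sum>k. (t - 1) ^ k * of_real (normalized_moment n k (1 / \<alpha>) (1 / \<beta>)))"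
proof -
  let ?p = "pochhammer (1 / \<beta> + 1 / \<alpha>) n"
  let ?Z = "(\<Sum>T\<in>ab_staircase_tableaux n. tableau_weight n \<alpha> \<beta> T)"
  have Z: "?Z = (\<alpha> * \<beta>) ^ n * ?p"
    using assms by (intro sum_tableau_weight) auto
  have p: "?p > 0"
    using assms by (intro pochhammer_pos) (auto intro: add_pos_pos)
  have "measure_pmf.expectation (random_ab_tableau n \<alpha> \<beta>) (\<lambda>T. t ^ second_diagonal_alphas n T) =
      (\<Sum>T\<in>ab_staircase_tableaux n. pmf (random_ab_tableau n \<alpha> \<beta>) T *\<^sub>R t ^ second_diagonal_alphas n T)"
    using assms by (intro integral_measure_pmf finite_ab_staircase_tableaux)
      (auto simp: set_pmf_iff pmf_random_ab_tableau split: if_splits)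
  also have "\<dots> = (\<Sum>T\<in>ab_staircase_tableaux n. of_real (tableau_weight n \<alpha> \<beta> T) * t ^ second_diagonal_alphas n T) / of_real ?Z"
    unfolding sum_divide_distrib
    using assms by (intro sum.cong refl) (simp add: pmf_random_ab_tableau scaleR_conv_of_real)
  also have "(\<Sum>T\<in>ab_staircase_tableaux n. of_real (tableau_weight n \<alpha> \<beta> T) * t ^ second_diagonal_alphas n T)
      = tableau_gf n (complex_of_real \<alpha>) (complex_of_real \<beta>) t (complex_of_real (\<beta> * (1 / \<beta>)))"
    using assms by (simp add: tableau_gf_def refined_weight_def tableau_weight_def)
  also have "\<dots> / of_real ?Z = (\<Sum>k\<le>n. (t - 1) ^ k * of_real (alpha_moment n k (1 / \<alpha>) (1 / \<beta>))) / of_real ?p"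
    unfolding Z using assms by (subst tableau_gf_eq) auto
  also have "\<dots> = (\<Sum>k\<le>n. (t - 1) ^ k * of_real (normalized_moment n k (1 / \<alpha>) (1 / \<beta>)))"
    by (simp add: sum_divide_distrib normalized_moment_def)
  \<comment> \<open>Terms beyond \<open>n\<close> vanish; an index range independent of
    \<open>n\<close> is what Tannery's theorem requires.\<close>
  also have "\<dots> = (\<Sum>k. (t - 1) ^ k * of_real (normalized_moment n k (1 / \<alpha>) (1 / \<beta>)))"
    by (rule suminf_finite[symmetric]) (auto simp: normalized_moment_def alpha_moment_eq_0)
  finally show ?thesis .
qed

text \<open>The series \<open>norm s ^ k / fact k\<close> dominates for all \<open>n\<close>, and
  the termwise limits sum to the exponential series at \<open>s / 2\<close>.\<close>

lemma normalized_moment_series_tendsto: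
  fixes s :: complex
  assumes "y > 0" "a > 0"
  shows "(\<lambda>n. \<Sum>k. s ^ k * of_real (normalized_moment n k a y)) \<longlonglongrightarrow> exp (s / 2)"
proof -
  have "(\<lambda>n. \<Sum>k. s ^ k * of_real (normalized_moment n k a y))
      \<longlonglongrightarrow> (\<Sum>k. s ^ k * of_real (1 / (2 ^ k * fact k)))"
  proof (intro conjunct2[OF conjunct2[OF tannerys_theorem]])
    show "(\<lambda>n. s ^ k * of_real (normalized_moment n k a y)) \<longlonglongrightarrow> s ^ k * of_real (1 / (2 ^ k * fact k))" for k
      by (intro tendsto_intros normalized_moment_tendsto assms)
    show "summable (\<lambda>k. norm s ^ k / fact k)"
      using summable_exp[of "norm s"] by (simp add: divide_inverse mult.commute)
    have "norm (s ^ k * of_real (normalized_moment n k a y)) \<le> norm s ^ k / fact k" for k n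
    proof -
      have "norm s ^ k * normalized_moment n k a y \<le> norm s ^ k * (1 / fact k)"
        using normalized_moment_bounds[OF assms] by (intro mult_left_mono) auto
      then show ?thesis
        using normalized_moment_bounds(1)[OF assms, of n k] by (simp add: norm_mult norm_power)
    qed
    then show "\<forall>\<^sub>F (k, n) in at_top \<times>\<^sub>F sequentially.
        norm (s ^ k * of_real (normalized_moment n k a y)) \<le> norm s ^ k / fact k"
      by (intro always_eventually) auto
  qed simp
  also have "(\<lambda>k. s ^ k * of_real (1 / (2 ^ k * fact k))) = (\<lambda>k. (s / 2) ^ k /\<^sub>R fact k)"
    by (auto simp: scaleR_conv_of_real power_divide field_simps)
  finally show ?thesis
    by (simp add: exp_def)
qed

lemma poisson_pgf:
  fixes t :: complex
  assumes "r > 0"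
  shows "measure_pmf.expectation (poisson_pmf r) (\<lambda>k. t ^ k) = exp (of_real r * (t - 1))"
proof -
  let ?f = "\<lambda>k. pmf (poisson_pmf r) k *\<^sub>R t ^ k"
  have eq: "?f = (\<lambda>k. exp (- of_real r) * ((of_real r * t) ^ k /\<^sub>R fact k))"
    using assms by (auto simp: scaleR_conv_of_real power_mult_distrib exp_of_real[symmetric] field_simps simp del: exp_of_real)
  have sums: "(\<lambda>k. exp (- of_real r) * ((of_real r * t) ^ k /\<^sub>R fact k)) sums (exp (- of_real r) * exp (of_real r * t))"
    by (intro sums_mult exp_converges)
  have "summable (\<lambda>k. norm (exp (- complex_of_real r)) * norm ((of_real r * t) ^ k /\<^sub>R fact k))"
    by (intro summable_mult summable_norm_exp)
  then have int: "integrable (count_space UNIV) ?f"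
    unfolding integrable_count_space_nat_iff eq norm_mult .
  have "measure_pmf.expectation (poisson_pmf r) (\<lambda>k. t ^ k) = integral\<^sup>L (count_space UNIV) ?f"
    unfolding measure_pmf_eq_density by (subst integral_density) auto
  also have "\<dots> = (\<Sum>k. ?f k)"
    by (rule integral_count_space_nat[OF int])
  also have "\<dots> = exp (- of_real r) * exp (of_real r * t)"
    unfolding eq using sums by (rule sums_unique[symmetric])
  also have "\<dots> = exp (of_real r * (t - 1))"
    by (simp add: exp_add[symmetric] algebra_simps)
  finally show ?thesis .
qed

lemma char_distr_nat:
  fixes X :: "'a \<Rightarrow> nat"
  shows "char (distr (measure_pmf p) borel (\<lambda>\<omega>. real (X \<omega>))) u = measure_pmf.expectation p (\<lambda>\<omega>. iexp u ^ X \<omega>)"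
  unfolding char_def
  by (subst integral_distr) (auto simp: exp_of_nat_mult[symmetric] mult_ac)

theorem theorem4p3:
  fixes \<alpha> \<beta> :: real
  assumes "\<alpha> > 0" and "\<beta> > 0"
  shows "weak_conv_m
    (\<lambda>n. distr (measure_pmf (random_ab_tableau n \<alpha> \<beta>)) borel
       (\<lambda>T. real (second_diagonal_alphas n T)))
    (distr (measure_pmf (poisson_pmf (1/2))) borel real)"
proof (rule levy_continuity)
  show "real_distribution (distr (measure_pmf (random_ab_tableau n \<alpha> \<beta>)) borel
       (\<lambda>T. real (second_diagonal_alphas n T)))" for n
    by (intro prob_space.real_distribution_distr prob_space_measure_pmf) simp
  show "real_distribution (distr (measure_pmf (poisson_pmf (1/2))) borel real)"
    by (intro prob_space.real_distribution_distr prob_space_measure_pmf) simp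
  fix u
  \<comment> \<open>The characteristic function is the probability generating function at
    \<open>t = iexp u\<close>, so both limits are \<open>exp (s / 2)\<close> with
    \<open>s = t - 1\<close>.\<close>
  have "char (distr (measure_pmf (poisson_pmf (1/2))) borel real) u = exp ((iexp u - 1) / 2)"
    using char_distr_nat[of "poisson_pmf (1/2)" "\<lambda>k. k" u] poisson_pgf[of "1/2" "iexp u"] by simp
  then show "(\<lambda>n. char (distr (measure_pmf (random_ab_tableau n \<alpha> \<beta>)) borel
       (\<lambda>T. real (second_diagonal_alphas n T))) u)
      \<longlonglongrightarrow> char (distr (measure_pmf (poisson_pmf (1/2))) borel real) u"
    unfolding char_distr_nat random_ab_tableau_pgf[OF assms]
    using normalized_moment_series_tendsto[of "1 / \<beta>" "1 / \<alpha>" "iexp u - 1"] assms by simp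
qed

end
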